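(* For positive integers $m,n$ let $\sigma(\mathbb{Z}_{m\times n})$ be the number of maximal independent sets of the $m\times n$ rectangular grid graph $\mathbb{Z}_{m\times n}$. Then the limit $$\kappa=\lim_{m,\,n\to\infty}\bigl(\sigma(\mathbb{Z}_{m\times n})\bigr)^{\frac{1}{mn}}$$ (the double limit as $m$ and $n$ both tend to infinity) exists, and more precisely $$\kappa=\sup_{m,\,n\ge 1}\bigl(\sigma(\mathbb{Z}_{m\times n})\bigr)^{\frac{1}{(m+1)(n+1)}}.$$
   Context: The grid graph $\mathbb{Z}_{m\times n}$ has vertex set $\{1,\dots,m\}\times\{1,\dots,n\}$, with two vertices adjacent iff they are horizontal or vertical nearest neighbours (i.e. they differ by exactly $1$ in one coordinate and agree in the other). An independent vertex set is a set of vertices no two of which are adjacent; a maximal independent set is an independent vertex set that is not a proper subset of any other independent vertex set. The number $\kappa$ is called the maximal hard square entropy constant. *)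

theory Defs
  imports Complex_Main
begin

text \<open>A graph is given by its vertex set \<open>V\<close> and a symmetric adjacency relation \<open>adj\<close>.\<close>

definition independent_set :: "'a set \<Rightarrow> ('a \<Rightarrow> 'a \<Rightarrow> bool) \<Rightarrow> 'a set \<Rightarrow> bool" where
  "independent_set V adj S \<longleftrightarrow> S \<subseteq> V \<and> (\<forall>u\<in>S. \<forall>v\<in>S. \<not> adj u v)"

definition maximal_independent_set :: "'a set \<Rightarrow> ('a \<Rightarrow> 'a \<Rightarrow> bool) \<Rightarrow> 'a set \<Rightarrow> bool" where
  "maximal_independent_set V adj S \<longleftrightarrow>
     independent_set V adj S \<and> \<not> (\<exists>T. independent_set V adj T \<and> S \<subset> T)"

definition grid_vertices :: "nat \<Rightarrow> nat \<Rightarrow> (nat \<times> nat) set" where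
  "grid_vertices m n = {1..m} \<times> {1..n}"

definition grid_adj :: "nat \<times> nat \<Rightarrow> nat \<times> nat \<Rightarrow> bool" where
  "grid_adj u v \<longleftrightarrow>
     (\<bar>int (fst u) - int (fst v)\<bar> = 1 \<and> snd u = snd v) \<or>
     (fst u = fst v \<and> \<bar>int (snd u) - int (snd v)\<bar> = 1)"

definition sigma_grid :: "nat \<Rightarrow> nat \<Rightarrow> nat" where
  "sigma_grid m n = card {S. maximal_independent_set (grid_vertices m n) grid_adj S}"

text \<open>The double limit is taken along the product filter, i.e. \<open>m\<close> and \<open>n\<close> tend to infinity
  independently of each other. \<open>Lim\<close> is a definite description, so this constant is
  meaningful only once convergence has been established.\<close>

definition max_hard_square_entropy :: real where
  "max_hard_square_entropy =
     Lim (sequentially \<times>\<^sub>F sequentially)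
       (\<lambda>(m, n). real (sigma_grid m n) powr (1 / (real m * real n)))"

end

theory Submission
  imports Defs
begin

text \<open>
  The count is supermultiplicative once a separating line is paid for. Put an \<open>m1 \<times> n\<close> and an
  \<open>m2 \<times> n\<close> grid side by side with one empty column between them. A maximal independent set of each
  block gives an independent set of the union, and this extends to a maximal independent set of the
  whole \<open>(m1 + m2 + 1) \<times> n\<close> grid; the extension can add vertices only in the separating column,
  because inside each block the set is maximal already. So both pieces can be read off from the
  extension, and \<open>\<sigma>(m1, n) \<sigma>(m2, n) \<le> \<sigma>(m1 + m2 + 1, n)\<close>
  (lemma \<open>mis_count_mult_le\<close> for graphs, \<open>sigma_grid_mult_le_fst\<close> for grids).

  The shift by one disappears in the variables \<open>a = m + 1\<close>, \<open>b = n + 1\<close>: the function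
  \<open>h a b = ln (\<sigma>(a - 1, b - 1))\<close> is nonnegative, superadditive in each variable, and at most
  \<open>a b ln 2\<close>, because there are only \<open>2 ^ (m n)\<close> vertex sets; this makes the supremum finite.
  Fekete's argument in two variables (lemma \<open>fekete_two_variables\<close>) then shows that
  \<open>h a b / (a b)\<close> converges to its supremum. This explains why the supremum carries
  the exponent \<open>1 / ((m + 1) (n + 1))\<close>. The limit may equally be taken with the exponent
  \<open>1 / (m n)\<close>, since the quotient of the two exponents tends to \<open>1\<close>.
\<close>

section \<open>Maximal independent sets of subgraphs\<close>

definition mis_count :: "'a set \<Rightarrow> ('a \<Rightarrow> 'a \<Rightarrow> bool) \<Rightarrow> nat" where
  "mis_count V adj = card {S. maximal_independent_set V adj S}"

lemma maximal_independent_setD: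
  assumes "maximal_independent_set V adj S"
  shows "independent_set V adj S" "S \<subseteq> V"
    and "\<And>T. independent_set V adj T \<Longrightarrow> S \<subseteq> T \<Longrightarrow> T = S"
proof -
  show ind: "independent_set V adj S"
    using assms unfolding maximal_independent_set_def by (rule conjunct1)
  then show "S \<subseteq> V" unfolding independent_set_def by (rule conjunct1)
  show "T = S" if "independent_set V adj T" "S \<subseteq> T" for T
    using assms that unfolding maximal_independent_set_def by blast
qed

lemma finite_maximal_independent_sets:
  assumes "finite V"
  shows "finite {S. maximal_independent_set V adj S}"
  by (rule finite_subset[of _ "Pow V"])
     (use assms in \<open>auto dest: maximal_independent_setD(2)\<close>)

lemma mis_count_le_power:
  assumes "finite V"
  shows "mis_count V adj \<le> 2 ^ card V"
proof -
  have "mis_count V adj \<le> card (Pow V)"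
    unfolding mis_count_def
    by (rule card_mono)
       (use assms in \<open>auto dest: maximal_independent_setD(2)\<close>)
  then show ?thesis using assms by (simp add: card_Pow)
qed

lemma independent_set_extends_to_maximal:
  assumes fin: "finite V" and ind: "independent_set V adj S"
  obtains M where "maximal_independent_set V adj M" "S \<subseteq> M"
proof -
  have "finite {T. independent_set V adj T}"
    by (rule finite_subset[of _ "Pow V"]) (use fin in \<open>auto simp: independent_set_def\<close>)
  from finite_has_maximal2[OF this, of S] ind obtain M where
    "independent_set V adj M" "S \<subseteq> M" "\<And>T. independent_set V adj T \<Longrightarrow> M \<subseteq> T \<Longrightarrow> M = T"
    by auto
  then have "maximal_independent_set V adj M"
    unfolding maximal_independent_set_def by blast
  with \<open>S \<subseteq> M\<close> show thesis using that by blast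
qed

lemma mis_count_pos:
  assumes "finite V"
  shows "mis_count V adj \<ge> 1"
proof -
  have "independent_set V adj {}" by (simp add: independent_set_def)
  then obtain M where "maximal_independent_set V adj M"
    using independent_set_extends_to_maximal[OF assms] by metis
  then have "card {S. maximal_independent_set V adj S} > 0"
    using finite_maximal_independent_sets[OF assms] by (auto simp: card_gt_0_iff)
  then show ?thesis by (simp add: mis_count_def)
qed

text \<open>
  Restriction to the two parts need not preserve maximality, so it is not a map between the sets
  that are counted here. It suffices that every pair of maximal independent sets of the parts is the
  restriction of some maximal independent set of the whole graph.
\<close>

lemma mis_count_mult_le:
  assumes fin: "finite V" and sub: "V1 \<subseteq> V" "V2 \<subseteq> V"
    and sep: "\<And>u v. u \<in> V1 \<Longrightarrow> v \<in> V2 \<Longrightarrow> \<not> adj u v \<and> \<not> adj v u"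
  shows "mis_count V1 adj * mis_count V2 adj \<le> mis_count V adj"
proof -
  let ?M = "\<lambda>W. {S. maximal_independent_set W adj S}"
  have "?M V1 \<times> ?M V2 \<subseteq> (\<lambda>S. (S \<inter> V1, S \<inter> V2)) ` ?M V"
  proof (clarify)
    fix S1 S2
    assume S1: "maximal_independent_set V1 adj S1" and S2: "maximal_independent_set V2 adj S2"
    have "independent_set V adj (S1 \<union> S2)"
      using maximal_independent_setD(1)[OF S1] maximal_independent_setD(1)[OF S2] sub sep
      unfolding independent_set_def by blast
    then obtain S where S: "maximal_independent_set V adj S" "S1 \<union> S2 \<subseteq> S"
      using independent_set_extends_to_maximal[OF fin] by metis
    have restrict: "S \<inter> W = T" if T: "maximal_independent_set W adj T" "T \<subseteq> S" for W T
    proof -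
      have "independent_set W adj (S \<inter> W)"
        using maximal_independent_setD(1)[OF S(1)] unfolding independent_set_def by blast
      moreover have "T \<subseteq> S \<inter> W"
        using T(2) maximal_independent_setD(2)[OF T(1)] by blast
      ultimately show ?thesis
        by (rule maximal_independent_setD(3)[OF T(1)])
    qed
    show "(S1, S2) \<in> (\<lambda>S. (S \<inter> V1, S \<inter> V2)) ` ?M V"
      using S restrict[OF S1] restrict[OF S2] by (intro image_eqI[of _ _ S]) auto
  qed
  then have "card (?M V1 \<times> ?M V2) \<le> card (?M V)"
    by (rule surj_card_le[OF finite_maximal_independent_sets[OF fin]])
  then show ?thesis by (simp add: mis_count_def card_cartesian_product)
qed

lemma mis_count_image:
  assumes inj: "inj_on f V"
    and adj: "\<And>u v. u \<in> V \<Longrightarrow> v \<in> V \<Longrightarrow> adj' (f u) (f v) \<longleftrightarrow> adj u v"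
  shows "mis_count (f ` V) adj' = mis_count V adj"
proof -
  have ind: "independent_set (f ` V) adj' (f ` S) \<longleftrightarrow> independent_set V adj S" if "S \<subseteq> V" for S
    using that by (auto simp: independent_set_def subset_iff adj)
  have psub: "f ` S \<subset> f ` T \<longleftrightarrow> S \<subset> T" if "S \<subseteq> V" "T \<subseteq> V" for S T
  proof -
    have "f ` (S \<union> T) = f ` T \<longleftrightarrow> S \<union> T = T"
      using that by (intro inj_on_image_eq_iff[OF inj]) auto
    then have "f ` S \<subseteq> f ` T \<longleftrightarrow> S \<subseteq> T"
      by (simp only: image_Un subset_Un_eq)
    then show ?thesis using that inj by (simp add: psubset_eq inj_on_image_eq_iff)
  qed
  define I where "I = {S. independent_set V adj S}"
  have I_sub: "S \<subseteq> V" if "S \<in> I" for S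
    using that by (simp add: I_def independent_set_def)
  have I_image: "{S'. independent_set (f ` V) adj' S'} = image f ` I"
  proof (intro equalityI subsetI)
    fix S' assume S': "S' \<in> {S'. independent_set (f ` V) adj' S'}"
    then have "S' \<subseteq> f ` V" by (simp add: independent_set_def)
    then obtain S where "S \<subseteq> V" "S' = f ` S" unfolding subset_image_iff by blast
    with S' ind[of S] show "S' \<in> image f ` I" by (simp add: I_def)
  next
    fix S' assume "S' \<in> image f ` I"
    then obtain S where "S \<in> I" "S' = f ` S" by blast
    with ind[of S] I_sub[of S] show "S' \<in> {S'. independent_set (f ` V) adj' S'}"
      by (simp add: I_def)
  qed
  have maximal_eq: "{S. maximal_independent_set W a S} =
      {S \<in> {S. independent_set W a S}. \<forall>T\<in>{S. independent_set W a S}. \<not> S \<subset> T}"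
    for W :: "'c set" and a
    unfolding maximal_independent_set_def by blast
  have "{S'. maximal_independent_set (f ` V) adj' S'} =
      image f ` {S \<in> I. \<forall>T\<in>I. \<not> f ` S \<subset> f ` T}"
    unfolding maximal_eq I_image Compr_image_eq ball_simps(9) by (rule refl)
  also have "{S \<in> I. \<forall>T\<in>I. \<not> f ` S \<subset> f ` T} = {S \<in> I. \<forall>T\<in>I. \<not> S \<subset> T}"
    by (rule Collect_cong, rule conj_cong, rule refl, rule ball_cong, rule refl)
       (simp only: psub[OF I_sub I_sub])
  also have "\<dots> = {S. maximal_independent_set V adj S}"
    unfolding maximal_eq I_def by (rule refl)
  finally have "{S'. maximal_independent_set (f ` V) adj' S'} =
      image f ` {S. maximal_independent_set V adj S}" .
  moreover have "inj_on (image f) {S. maximal_independent_set V adj S}"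
    by (rule inj_on_subset[OF inj_on_image_Pow[OF inj]])
       (auto dest: maximal_independent_setD(2))
  ultimately show ?thesis by (simp add: mis_count_def card_image)
qed

section \<open>Supermultiplicativity for grids\<close>

lemma sigma_grid_eq: "sigma_grid m n = mis_count (grid_vertices m n) grid_adj"
  by (simp add: sigma_grid_def mis_count_def)

lemma finite_grid_vertices: "finite (grid_vertices m n)"
  by (simp add: grid_vertices_def)

lemma sigma_grid_pos: "sigma_grid m n \<ge> 1"
  by (simp add: sigma_grid_eq mis_count_pos[OF finite_grid_vertices, simplified])

lemma sigma_grid_le: "sigma_grid m n \<le> 2 ^ (m * n)"
  using mis_count_le_power[OF finite_grid_vertices, of m n grid_adj]
  by (simp add: sigma_grid_eq grid_vertices_def card_cartesian_product)

lemma sigma_grid_swap: "sigma_grid m n = sigma_grid n m"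
proof -
  have "grid_vertices m n = prod.swap ` grid_vertices n m"
    by (simp add: grid_vertices_def product_swap)
  moreover have "mis_count (prod.swap ` grid_vertices n m) grid_adj =
      mis_count (grid_vertices n m) grid_adj"
    by (rule mis_count_image) (auto simp: grid_adj_def)
  ultimately show ?thesis by (simp add: sigma_grid_eq)
qed

lemma sigma_grid_mult_le_fst:
  "sigma_grid m1 n * sigma_grid m2 n \<le> sigma_grid (m1 + m2 + 1) n"
proof -
  define shift :: "nat \<times> nat \<Rightarrow> nat \<times> nat" where "shift = (\<lambda>(i, j). (i + (m1 + 1), j))"
  let ?R = "shift ` grid_vertices m2 n"
  have "mis_count (grid_vertices m1 n) grid_adj * mis_count ?R grid_adj
      \<le> mis_count (grid_vertices (m1 + m2 + 1) n) grid_adj"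
    by (rule mis_count_mult_le)
       (auto simp: finite_grid_vertices, auto simp: grid_vertices_def shift_def grid_adj_def)
  moreover have "mis_count ?R grid_adj = mis_count (grid_vertices m2 n) grid_adj"
    by (rule mis_count_image) (auto simp: shift_def grid_adj_def inj_on_def)
  ultimately show ?thesis by (simp add: sigma_grid_eq)
qed

section \<open>Superadditive functions of two variables\<close>

lemma filterlim_fst_prod_filter: "filterlim fst F (F \<times>\<^sub>F G)"
  by (simp add: filterlim_def filtermap_fst_prod_filter)

lemma filterlim_snd_prod_filter: "filterlim snd G (F \<times>\<^sub>F G)"
  by (simp add: filterlim_def filtermap_snd_prod_filter)

text \<open>
  Split \<open>A\<close> into \<open>A div a\<close> pieces of length \<open>a\<close> and a remainder, whose contribution is nonnegative
  and can be dropped.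
\<close>

lemma superadditive_mult_le:
  fixes f :: "nat \<Rightarrow> real"
  assumes nonneg: "\<And>a. f a \<ge> 0" and super: "\<And>a b. f a + f b \<le> f (a + b)"
  shows "real (A div a) * f a \<le> f A"
proof -
  have "real q * f a \<le> f (q * a)" for q
  proof (induction q)
    case (Suc q)
    then show ?case using super[of a "q * a"] by (simp add: algebra_simps)
  qed (simp add: nonneg)
  from this[of "A div a"] have "real (A div a) * f a \<le> f (A div a * a) + f (A mod a)"
    using nonneg[of "A mod a"] by linarith
  also have "\<dots> \<le> f A" using super[of "A div a * a" "A mod a"] by simp
  finally show ?thesis .
qed

lemma div_over_tendsto:
  assumes "a \<ge> (1::nat)"
  shows "(\<lambda>A. real (A div a) / real A) \<longlonglongrightarrow> 1 / real a"
proof (rule tendsto_sandwich)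
  show "(\<lambda>A. 1 / real a - 1 / real A) \<longlonglongrightarrow> 1 / real a"
    using tendsto_diff[OF tendsto_const[of "1 / real a"] lim_1_over_n] by simp
  show "\<forall>\<^sub>F A in sequentially. 1 / real a - 1 / real A \<le> real (A div a) / real A"
    using eventually_gt_at_top[of 0]
  proof eventually_elim
    case (elim A)
    have "real (A mod a) / real a \<le> 1"
      using assms by (simp add: less_imp_le)
    then have "real A / real a - 1 \<le> real (A div a)"
      using of_nat_of_nat_div_aux[of A a, where ?'a = real] by linarith
    then have "(real A / real a - 1) / real A \<le> real (A div a) / real A"
      by (rule divide_right_mono) simp
    then show ?case using elim by (simp add: diff_divide_distrib)
  qed
  show "\<forall>\<^sub>F A in sequentially. real (A div a) / real A \<le> 1 / real a"
    using eventually_gt_at_top[of 0]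
  proof eventually_elim
    case (elim A)
    then show ?case
      using divide_right_mono[OF of_nat_div_le_of_nat[of A a], of "real A"] by simp
  qed
qed simp

text \<open>
  A rectangle \<open>A \<times> B\<close> contains \<open>(A div a) (B div b)\<close> disjoint copies of \<open>a \<times> b\<close>, which cover
  asymptotically all of it. So the density of any fixed rectangle is, in the limit, a lower
  bound for the density of every large one.
\<close>

lemma fekete_two_variables:
  fixes h :: "nat \<Rightarrow> nat \<Rightarrow> real"
  assumes nonneg: "\<And>a b. h a b \<ge> 0"
    and super1: "\<And>a a' b. h a b + h a' b \<le> h (a + a') b"
    and super2: "\<And>a b b'. h a b + h a b' \<le> h a (b + b')"
    and bdd: "bdd_above ((\<lambda>(a, b). h a b / (real a * real b)) ` ({1..} \<times> {1..}))"
  shows "((\<lambda>(a, b). h a b / (real a * real b)) \<longlongrightarrow>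
      (SUP (a, b)\<in>{1..} \<times> {1..}. h a b / (real a * real b))) (sequentially \<times>\<^sub>F sequentially)"
    (is "(?d \<longlongrightarrow> ?s) ?F")
proof (rule order_tendstoI)
  have pos: "\<forall>\<^sub>F (a, b) in ?F. (a, b) \<in> {1..} \<times> {1..}"
    using eventually_prodI[OF eventually_ge_at_top[of "1::nat"] eventually_ge_at_top[of "1::nat"]]
    by (simp add: case_prod_unfold mem_Times_iff)
  fix y
  {
    assume "y > ?s"
    from pos show "\<forall>\<^sub>F x in ?F. ?d x < y"
    proof eventually_elim
      case (elim x)
      then have "?d x \<le> ?s" using bdd by (intro cSUP_upper) auto
      with \<open>y > ?s\<close> show ?case by simp
    qed
  next
    assume "y < ?s"
    then obtain a b where ab: "a \<ge> 1" "b \<ge> 1" "y < h a b / (real a * real b)"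
      using less_cSUP_iff[OF _ bdd, of y] by (auto simp: Sigma_empty_iff)
    let ?l = "\<lambda>x. (real (fst x div a) / real (fst x)) * (real (snd x div b) / real (snd x)) * h a b"
    have "(?l \<longlongrightarrow> 1 / real a * (1 / real b) * h a b) ?F"
      by (intro tendsto_mult tendsto_const
          filterlim_compose[OF div_over_tendsto[OF ab(1)] filterlim_fst_prod_filter]
          filterlim_compose[OF div_over_tendsto[OF ab(2)] filterlim_snd_prod_filter])
    then have "\<forall>\<^sub>F x in ?F. y < ?l x"
      using ab(3) by (intro order_tendstoD) auto
    with pos show "\<forall>\<^sub>F x in ?F. y < ?d x"
    proof eventually_elim
      case (elim x)
      obtain A B where x: "x = (A, B)" by (cases x)
      have "real (A div a) * (real (B div b) * h a b) \<le> real (A div a) * h a B"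
        by (intro mult_left_mono superadditive_mult_le nonneg super2) simp
      also have "\<dots> \<le> h A B"
        by (rule superadditive_mult_le[of "\<lambda>a. h a B"]) (auto intro: nonneg super1)
      finally have "real (A div a) * (real (B div b) * h a b) / (real A * real B)
          \<le> h A B / (real A * real B)"
        by (rule divide_right_mono) simp
      then show ?case using elim by (simp add: x mult_ac)
    qed
  }
qed

section \<open>The entropy constant\<close>

text \<open>
  The variables are shifted by one, so that the separating line is absorbed. At \<open>0\<close> the truncated
  subtraction gives the grid without vertices, whose only maximal independent set is empty; the
  resulting value \<open>0\<close> is the one that keeps superadditivity valid when a summand is \<open>0\<close>.
\<close>

definition log_sigma :: "nat \<Rightarrow> nat \<Rightarrow> real" where
  "log_sigma a b = ln (real (sigma_grid (a - 1) (b - 1)))"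

lemma log_sigma_nonneg: "log_sigma a b \<ge> 0"
  unfolding log_sigma_def using sigma_grid_pos[of "a - 1" "b - 1"] by simp

lemma log_sigma_0: "log_sigma 0 b = 0"
  using sigma_grid_le[of 0 "b - 1"] sigma_grid_pos[of 0 "b - 1"] by (simp add: log_sigma_def)

lemma log_sigma_swap: "log_sigma a b = log_sigma b a"
  unfolding log_sigma_def by (subst sigma_grid_swap) (rule refl)

lemma log_sigma_superadditive_fst: "log_sigma a b + log_sigma a' b \<le> log_sigma (a + a') b"
proof (cases "a = 0 \<or> a' = 0")
  case True
  then show ?thesis by (auto simp: log_sigma_0)
next
  case False
  have eq: "a - 1 + (a' - 1) + 1 = a + a' - 1" using False by linarith
  let ?s = "\<lambda>a. real (sigma_grid (a - 1) (b - 1))"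
  have pos: "?s a > 0" for a using sigma_grid_pos[of "a - 1" "b - 1"] by simp
  have "?s a * ?s a' \<le> ?s (a + a')"
    using sigma_grid_mult_le_fst[of "a - 1" "b - 1" "a' - 1"]
    unfolding eq of_nat_mult[symmetric] of_nat_le_iff .
  then have "ln (?s a * ?s a') \<le> ln (?s (a + a'))"
    using pos by (intro ln_mono mult_pos_pos)
  then show ?thesis using pos by (simp add: log_sigma_def ln_mult_pos)
qed

lemma log_sigma_superadditive_snd: "log_sigma a b + log_sigma a b' \<le> log_sigma a (b + b')"
  using log_sigma_superadditive_fst[of b a b'] by (simp add: log_sigma_swap[of a])

lemma log_sigma_le: "log_sigma a b \<le> real a * real b * ln 2"
proof -
  let ?m = "a - 1" and ?n = "b - 1"
  have "real (sigma_grid ?m ?n) \<le> 2 ^ (?m * ?n)"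
    using sigma_grid_le[of ?m ?n] by (metis of_nat_le_iff of_nat_numeral of_nat_power)
  then have "log_sigma a b \<le> ln (2 ^ (?m * ?n))"
    unfolding log_sigma_def using sigma_grid_pos[of ?m ?n] by (intro ln_mono) auto
  also have "\<dots> = real ?m * real ?n * ln 2" by (simp add: ln_realpow)
  also have "\<dots> \<le> real a * real b * ln 2" by (intro mult_right_mono mult_mono) auto
  finally show ?thesis .
qed

lemma sigma_grid_powr:
  "real (sigma_grid m n) powr (1 / e) = exp (log_sigma (Suc m) (Suc n) / e)"
  using sigma_grid_pos[of m n] by (simp add: powr_def log_sigma_def)

theorem theorem2:
  shows "((\<lambda>(m, n). real (sigma_grid m n) powr (1 / (real m * real n)))
            \<longlongrightarrow> max_hard_square_entropy) (sequentially \<times>\<^sub>F sequentially)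
       \<and> bdd_above ((\<lambda>(m, n). real (sigma_grid m n) powr (1 / ((real m + 1) * (real n + 1))))
            ` ({1..} \<times> {1..}))
       \<and> max_hard_square_entropy =
           (SUP (m, n)\<in>{1..} \<times> {1..}.
              real (sigma_grid m n) powr (1 / ((real m + 1) * (real n + 1))))"
proof -
  let ?F = "sequentially \<times>\<^sub>F sequentially :: (nat \<times> nat) filter"
  let ?x = "\<lambda>(m, n). real (sigma_grid m n) powr (1 / ((real m + 1) * (real n + 1)))"
  let ?z = "\<lambda>(m, n). real (sigma_grid m n) powr (1 / (real m * real n))"
  define d where "d = (\<lambda>(a, b). log_sigma a b / (real a * real b))"
  define s where "s = (SUP x\<in>{1..} \<times> {1..}. d x)"
  have "d (a, b) \<le> ln 2" if "a \<ge> 1" "b \<ge> 1" for a b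
  proof -
    have "d (a, b) \<le> real a * real b * ln 2 / (real a * real b)"
      unfolding d_def prod.case by (rule divide_right_mono[OF log_sigma_le]) simp
    then show ?thesis using that by simp
  qed
  then have bdd: "bdd_above (d ` ({1..} \<times> {1..}))" by (auto intro!: bdd_aboveI2)
  have d_lim: "(d \<longlongrightarrow> s) ?F"
    using fekete_two_variables[of log_sigma, OF log_sigma_nonneg log_sigma_superadditive_fst
        log_sigma_superadditive_snd] bdd
    by (simp add: d_def s_def)
  have Suc_lim: "filterlim (\<lambda>x. (Suc (fst x), Suc (snd x))) ?F ?F"
    by (intro filterlim_Pair filterlim_compose[OF filterlim_Suc]
        filterlim_fst_prod_filter filterlim_snd_prod_filter)
  have dSuc_lim: "((\<lambda>x. d (Suc (fst x), Suc (snd x))) \<longlongrightarrow> s) ?F"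
    using filterlim_compose[OF d_lim Suc_lim] .
  have x_eq: "?x = (\<lambda>x. exp (d (Suc (fst x), Suc (snd x))))"
    by (auto simp: fun_eq_iff sigma_grid_powr d_def add_ac)
  have x_lim: "(?x \<longlongrightarrow> exp s) ?F"
    unfolding x_eq by (intro tendsto_exp dSuc_lim)

  \<comment> \<open>Passing from the exponent \<open>1 / ((m + 1) (n + 1))\<close> to \<open>1 / (m n)\<close> multiplies the logarithm
    by \<open>((m + 1) / m) ((n + 1) / n)\<close>.\<close>
  have "(\<lambda>m. real (Suc m) / real m) \<longlonglongrightarrow> 1"
    by (rule LIMSEQ_Suc_n_over_n)
  then have corr: "((\<lambda>x. real (Suc (fst x)) / real (fst x)) \<longlongrightarrow> 1) ?F"
      "((\<lambda>x. real (Suc (snd x)) / real (snd x)) \<longlongrightarrow> 1) ?F"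
    by (rule filterlim_compose[OF _ filterlim_fst_prod_filter],
        rule filterlim_compose[OF _ filterlim_snd_prod_filter])
  have "((\<lambda>x. exp (d (Suc (fst x), Suc (snd x)) * (real (Suc (fst x)) / real (fst x))
      * (real (Suc (snd x)) / real (snd x)))) \<longlongrightarrow> exp (s * 1 * 1)) ?F"
    by (intro tendsto_exp tendsto_mult dSuc_lim corr)
  moreover have "exp (d (Suc (fst x), Suc (snd x)) * (real (Suc (fst x)) / real (fst x))
      * (real (Suc (snd x)) / real (snd x))) = ?z x" for x
    by (cases x) (simp add: sigma_grid_powr d_def del: of_nat_Suc)
  ultimately have z_lim: "(?z \<longlongrightarrow> exp s) ?F" by simp

  have nontriv: "?F \<noteq> bot" by (simp add: prod_filter_eq_bot)
  have entropy: "max_hard_square_entropy = exp s"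
    unfolding max_hard_square_entropy_def by (rule tendsto_Lim[OF nontriv z_lim])

  have x_le: "?x x \<le> exp s" for x
    unfolding x_eq s_def exp_le_cancel_iff by (rule cSUP_upper[OF _ bdd]) simp
  \<comment> \<open>Every upper bound of the sequence also bounds its limit \<open>exp s\<close>. The supremum here omits
    the values of \<open>d\<close> with \<open>a = 1\<close> or \<open>b = 1\<close>, which \<open>s\<close> includes; the limit is insensitive to
    them.\<close>
  have "(SUP x\<in>{1..} \<times> {1..}. ?x x) = exp s"
  proof (rule cSup_eq_non_empty)
    fix y assume ub: "\<And>v. v \<in> ?x ` ({1..} \<times> {1..}) \<Longrightarrow> v \<le> y"
    have "\<forall>\<^sub>F x in ?F. ?x x \<le> y"
      using eventually_prodI[OF eventually_ge_at_top[of 1] eventually_ge_at_top[of 1]]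
      by eventually_elim (rule ub, auto)
    then show "exp s \<le> y" by (rule tendsto_upperbound[OF x_lim _ nontriv])
  qed (use x_le in auto)
  then show ?thesis
    using z_lim x_le by (auto simp: entropy intro!: bdd_aboveI2)
qed

end
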